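(* Let $\mathbf{A}\in\mathbb{R}^{n\times n}$, $\mathbf{b}\in\mathbb{R}^n$, let $\mathbf{x}^*$ be the exact solution of $\mathbf{A}\mathbf{x}=\mathbf{b}$, $\mathbf{M}=\mathbf{I}-\mathbf{A}$, and $q(\mathbf{x})=\mathbf{M}\mathbf{x}+\mathbf{b}$. Consider the aAA($m$)[$s$]--FP[$t$] method with $m\le t$ applied to the fixed-point iteration $\mathbf{x}_{k+1}=q(\mathbf{x}_k)$, with iterates $\{\mathbf{x}_k\}$, and let $p=t+s$. Assume that $\mathbf{M}$ is diagonalizable, $\mathbf{M}=\mathbf{W}\mathbf{\Lambda}\mathbf{W}^{-1}$ with $\mathbf{W}\in\mathbb{R}^{n\times n}$ invertible and $\mathbf{\Lambda}$ real diagonal, and that all eigenvalues of $\mathbf{M}$ lie in the interval $[a,b]$, where $1<a<b$. If $$2\,\kappa_2(\mathbf{W})\left(\frac{\sqrt{\frac{a(1-b)}{b(1-a)}}-1}{\sqrt{\frac{a(1-b)}{b(1-a)}}+1}\right)^m\|\mathbf{M}\|^{t+s}<1,$$ then the subsequence $\{\mathbf{x}_{jp}\}_{j\ge 0}$ converges (to $\mathbf{x}^*$). Additionally, if $\mathbf{M}$ is symmetric and $$2\left(\frac{\sqrt{\frac{a(1-b)}{b(1-a)}}-1}{\sqrt{\frac{a(1-b)}{b(1-a)}}+1}\right)^m b^{\,t+s}<1,$$ then the subsequence $\{\mathbf{x}_{jp}\}_{j\ge 0}$ converges (to $\mathbf{x}^*$).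
   Context: $\|\cdot\|$ is the Euclidean norm and the induced matrix norm; $\kappa_2(\mathbf{W})=\|\mathbf{W}\|\,\|\mathbf{W}^{-1}\|$. The residual function is $r(\mathbf{x})=q(\mathbf{x})-\mathbf{x}=\mathbf{b}-\mathbf{A}\mathbf{x}$. Anderson step: given $\mathbf{x}_0,\dots,\mathbf{x}_k$ and an integer window size $m\ge 0$, put $m_k=\min\{m,k\}$. The AA($m$) update is $$\mathbf{x}_{k+1}=q(\mathbf{x}_k)+\sum_{i=1}^{m_k}\gamma_i^{(k)}\bigl(q(\mathbf{x}_k)-q(\mathbf{x}_{k-i})\bigr),$$ where $(\gamma_1^{(k)},\dots,\gamma_{m_k}^{(k)})\in\mathbb{R}^{m_k}$ is a minimizer of $\bigl\|r(\mathbf{x}_k)+\sum_{i=1}^{m_k}\gamma_i\,(r(\mathbf{x}_k)-r(\mathbf{x}_{k-i}))\bigr\|^2$. The method aAA($m$)[$s$]--FP[$t$] (integers $s\ge1$, $t\ge0$) starts from an arbitrary $\mathbf{x}_0\in\mathbb{R}^n$, and for each $k\ge 0$: if $k \bmod (s+t)<t$, then $\mathbf{x}_{k+1}=q(\mathbf{x}_k)$ (fixed-point step); otherwise $\mathbf{x}_{k+1}$ is the AA($m$) update. Thus it repeats $t$ fixed-point steps followed by $s$ Anderson steps; the history used by an Anderson step consists of all preceding iterates within the window, whether produced by fixed-point or Anderson steps. *)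

theory Defs
  imports "HOL-Analysis.Analysis"
begin

(* The library norm on real ^ 'n ^ 'm is the Frobenius norm, so the matrix norm
   induced by the Euclidean norm is written with onorm. *)
definition mat_norm2 :: "real ^ 'n ^ 'm \<Rightarrow> real"
  where "mat_norm2 M = onorm (\<lambda>x. M *v x)"

definition cond2 :: "real ^ 'n ^ 'n \<Rightarrow> real"
  where "cond2 W = mat_norm2 W * mat_norm2 (matrix_inv W)"

definition diagonal_matrix :: "real ^ 'n ^ 'n \<Rightarrow> bool"
  where "diagonal_matrix D \<longleftrightarrow> (\<forall>i j. i \<noteq> j \<longrightarrow> D $ i $ j = 0)"

definition symmetric_matrix :: "real ^ 'n ^ 'n \<Rightarrow> bool"
  where "symmetric_matrix M \<longleftrightarrow> transpose M = M"

(* Real eigenvalues only; these are all the eigenvalues of a matrix that is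
   diagonalizable over the reals. *)
definition eigenvalue :: "real ^ 'n ^ 'n \<Rightarrow> real \<Rightarrow> bool"
  where "eigenvalue M l \<longleftrightarrow> (\<exists>v. v \<noteq> 0 \<and> M *v v = l *\<^sub>R v)"

definition residual :: "('a::real_inner \<Rightarrow> 'a) \<Rightarrow> 'a \<Rightarrow> 'a"
  where "residual q x = q x - x"

(* A coefficient vector (g 1, ..., g d) is a function nat => real of which only the
   values at 1, ..., d are used, where d = min m k; the remaining values are irrelevant. *)
definition anderson_objective ::
    "('a::real_inner \<Rightarrow> 'a) \<Rightarrow> nat \<Rightarrow> (nat \<Rightarrow> 'a) \<Rightarrow> nat \<Rightarrow> (nat \<Rightarrow> real) \<Rightarrow> real"
  where "anderson_objective q m x k g =
    (norm (residual q (x k)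
       + (\<Sum>i = 1..min m k. g i *\<^sub>R (residual q (x k) - residual q (x (k - i))))))\<^sup>2"

(* The least-squares minimizer need not be unique, so an Anderson step is a relation
   and any minimizer may be chosen. *)
definition anderson_step :: "('a::real_inner \<Rightarrow> 'a) \<Rightarrow> nat \<Rightarrow> (nat \<Rightarrow> 'a) \<Rightarrow> nat \<Rightarrow> bool"
  where "anderson_step q m x k \<longleftrightarrow>
    (\<exists>g. is_arg_min (anderson_objective q m x k) (\<lambda>_. True) g \<and>
         x (Suc k) = q (x k) + (\<Sum>i = 1..min m k. g i *\<^sub>R (q (x k) - q (x (k - i)))))"

(* x is a sequence of iterates of aAA(m)[s]--FP[t] for q; x 0 is arbitrary. *)
definition aAA_FP_iterates ::
    "('a::real_inner \<Rightarrow> 'a) \<Rightarrow> nat \<Rightarrow> nat \<Rightarrow> nat \<Rightarrow> (nat \<Rightarrow> 'a) \<Rightarrow> bool"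
  where "aAA_FP_iterates q m s t x \<longleftrightarrow>
    (\<forall>k. if k mod (s + t) < t then x (Suc k) = q (x k) else anderson_step q m x k)"

end

theory Submission
  imports Defs
begin

text \<open>
  Errors and residuals obey the same linear recursion, and an Anderson step applies \<open>M\<close> to the
  minimal combined residual. Taking zero coefficients shows that every Anderson step costs at most
  a factor \<open>\<parallel>M\<parallel>\<close>. In the first Anderson step of a cycle the history consists of the vectors
  \<open>M\<^sup>t\<^sup>-\<^sup>i r\<close>, so the minimum is taken over all \<open>P(M\<^sup>-\<^sup>1) M\<^sup>t r\<close> with \<open>deg P \<le> m\<close> and \<open>P(1) = 1\<close>.
  The spectrum of \<open>M\<^sup>-\<^sup>1\<close> lies in \<open>[1/b, 1/a]\<close>, to the left of \<open>1\<close>, and the Chebyshev polynomial of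
  this interval, normalised at \<open>1\<close>, is bounded there by \<open>2 \<rho>\<^sup>m\<close>.
\<close>

section \<open>Chebyshev polynomials and their growth outside \<open>[-1, 1]\<close>\<close>

fun chebyshev :: "nat \<Rightarrow> real poly" where
  "chebyshev 0 = 1"
| "chebyshev (Suc 0) = [:0, 1:]"
| "chebyshev (Suc (Suc n)) = [:0, 2:] * chebyshev (Suc n) - chebyshev n"

lemma degree_chebyshev_le: "degree (chebyshev n) \<le> n"
proof (induction n rule: chebyshev.induct)
  case (3 n)
  have "degree ([:0, 2:] * chebyshev (Suc n)) \<le> Suc (Suc n)"
    using degree_mult_le[of "[:0, 2:]" "chebyshev (Suc n)"] 3 by simp
  then show ?case using 3 by (auto intro!: degree_diff_le)
qed auto

lemma poly_chebyshev_cos: "poly (chebyshev n) (cos \<theta>) = cos (real n * \<theta>)"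
proof (induction n rule: chebyshev.induct)
  case (3 n)
  have "cos (real (Suc n) * \<theta> + \<theta>) + cos (real (Suc n) * \<theta> - \<theta>) = 2 * cos \<theta> * cos (real (Suc n) * \<theta>)"
    by (simp add: cos_add cos_diff)
  moreover have "real (Suc n) * \<theta> + \<theta> = real (Suc (Suc n)) * \<theta>" "real (Suc n) * \<theta> - \<theta> = real n * \<theta>"
    by (simp_all add: algebra_simps)
  ultimately show ?case using 3 by (simp del: of_nat_Suc)
qed auto

lemma abs_poly_chebyshev_le_1: "\<bar>y\<bar> \<le> 1 \<Longrightarrow> \<bar>poly (chebyshev n) y\<bar> \<le> 1"
  using poly_chebyshev_cos[of n "arccos y"] by (simp add: cos_arccos_abs)

text \<open>Outside \<open>[-1, 1]\<close> this replaces the cosine formula: since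
  \<open>z * inverse z = 1\<close>, the sequence \<open>z ^ n + inverse z ^ n\<close> obeys the
  Chebyshev recurrence with \<open>z + inverse z\<close> in the role of twice the argument.\<close>

lemma poly_chebyshev_joukowski:
  assumes "z \<noteq> 0"
  shows "poly (chebyshev n) ((z + inverse z) / 2) = (z ^ n + inverse z ^ n) / 2"
proof (induction n rule: chebyshev.induct)
  case (3 n)
  have "(z + w) * (z * A + w * B) = z * (z * A) + w * (w * B) + z * w * (A + B)" for w A B :: real
    by (simp add: algebra_simps)
  from this[of "inverse z" "z ^ n" "inverse z ^ n"]
  have "(z + inverse z) * (z ^ Suc n + inverse z ^ Suc n)
      = z ^ Suc (Suc n) + inverse z ^ Suc (Suc n) + (z ^ n + inverse z ^ n)"
    using assms by simp
  then show ?case using 3 by (simp add: field_simps)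
qed auto

text \<open>An affine map carries \<open>[u, v]\<close> onto \<open>[-1, 1]\<close> and sends
  \<open>1\<close> to a point beyond it. The Chebyshev polynomial is at most 1 in absolute value on
  the interval and large at that point, so dividing by the latter value gives
  \<open>P\<close>.\<close>

lemma exists_small_poly:
  fixes u v :: real
  assumes "u < v" "v < 1"
  defines "\<kappa> \<equiv> (1 - u) / (1 - v)"
  shows "\<exists>P. degree P \<le> m \<and> poly P 1 = 1 \<and>
      (\<forall>y\<in>{u..v}. \<bar>poly P y\<bar> \<le> 2 * ((sqrt \<kappa> - 1) / (sqrt \<kappa> + 1)) ^ m)"
proof -
  define \<rho> where "\<rho> = (sqrt \<kappa> - 1) / (sqrt \<kappa> + 1)"
  define T where "T = pcompose (chebyshev m) [:- (u + v) / (v - u), 2 / (v - u):]"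
  have \<kappa>: "\<kappa> > 1" using assms by (simp add: \<kappa>_def)
  then have sq: "sqrt \<kappa> > 1" "sqrt \<kappa> * sqrt \<kappa> = \<kappa>" by auto
  then have \<rho>: "\<rho> > 0" unfolding \<rho>_def by (intro divide_pos_pos) linarith+
  have T: "poly T y = poly (chebyshev m) ((2 * y - u - v) / (v - u))" for y
    using assms by (simp add: T_def poly_pcompose diff_divide_distrib add_divide_distrib algebra_simps)
  \<comment> \<open>This value of \<open>\<rho>\<close> is chosen so that the affine image of
    \<open>1\<close> is \<open>(inverse \<rho> + \<rho>) / 2\<close>, the form in which the
    Chebyshev value is explicit.\<close>
  have "inverse \<rho> + \<rho> = 2 * (\<kappa> + 1) / (\<kappa> - 1)"
  proof -
    have "(sqrt \<kappa> + 1) * (sqrt \<kappa> - 1) = \<kappa> - 1" using sq by (simp add: algebra_simps)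
    moreover have "inverse \<rho> + \<rho> = ((sqrt \<kappa> + 1)\<^sup>2 + (sqrt \<kappa> - 1)\<^sup>2) / ((sqrt \<kappa> + 1) * (sqrt \<kappa> - 1))"
      using sq(1) by (simp add: \<rho>_def divide_simps power2_eq_square)
    moreover have "(sqrt \<kappa> + 1)\<^sup>2 + (sqrt \<kappa> - 1)\<^sup>2 = 2 * (\<kappa> + 1)"
      using sq(2) by (simp add: power2_eq_square algebra_simps)
    ultimately show ?thesis by simp
  qed
  also have "\<dots> = 2 * ((2 - u - v) / (v - u))"
  proof -
    have "\<kappa> + 1 = (2 - u - v) / (1 - v)" "\<kappa> - 1 = (v - u) / (1 - v)"
      using assms(1,2) unfolding \<kappa>_def by (simp_all add: field_simps)
    then show ?thesis using assms(2) by (simp only: times_divide_eq_right) simp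
  qed
  finally have mid: "(inverse \<rho> + \<rho>) / 2 = (2 - u - v) / (v - u)"
    by (simp only: nonzero_mult_div_cancel_left[OF zero_neq_numeral[symmetric]])
  have "inverse \<rho> \<noteq> 0" using \<rho> by simp
  from poly_chebyshev_joukowski[OF this, of m]
  have T1: "poly T 1 = (inverse \<rho> ^ m + \<rho> ^ m) / 2"
    unfolding inverse_inverse_eq mid T mult_1_right .
  \<comment> \<open>Dropping the positive term \<open>\<rho> ^ m / 2\<close> relaxes the bound
    \<open>2 / (inverse \<rho> ^ m + \<rho> ^ m)\<close> to \<open>2 * \<rho> ^ m\<close>.\<close>
  have T1_ge: "inverse \<rho> ^ m / 2 \<le> poly T 1" using T1 \<rho> by simp
  have pos: "inverse \<rho> ^ m / 2 > 0" using \<rho> by simp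
  define P where "P = smult (inverse (poly T 1)) T"
  have "degree T \<le> m"
    using degree_chebyshev_le[of m] degree_pcompose_le[of "chebyshev m" "[:- (u + v) / (v - u), 2 / (v - u):]"]
    by (simp add: T_def split: if_splits)
  then have "degree P \<le> m" by (simp add: P_def)
  moreover have "poly P 1 = 1" using T1_ge pos by (simp add: P_def)
  moreover have "\<bar>poly P y\<bar> \<le> 2 * \<rho> ^ m" if "y \<in> {u..v}" for y
  proof -
    have "\<bar>(2 * y - u - v) / (v - u)\<bar> \<le> 1" using that assms by (auto simp: abs_le_iff field_simps)
    then have "\<bar>poly T y\<bar> \<le> 1" unfolding T by (rule abs_poly_chebyshev_le_1)
    then have "\<bar>poly P y\<bar> \<le> inverse (poly T 1)"
      using T1_ge pos by (simp add: P_def abs_mult mult_left_le)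
    also have "\<dots> \<le> inverse (inverse \<rho> ^ m / 2)"
      using T1_ge pos by (rule le_imp_inverse_le)
    also have "\<dots> = 2 * \<rho> ^ m" 
      unfolding inverse_divide power_inverse unfolding divide_inverse inverse_inverse_eq ..
    finally show ?thesis .
  qed
  ultimately show ?thesis unfolding \<rho>_def by blast
qed

text \<open>Going back \<open>i\<close> fixed-point steps divides the component for an eigenvalue
  \<open>l\<close> by \<open>l ^ i\<close>, hence the powers of \<open>inverse l\<close>. With
  \<open>u = inverse b\<close> and \<open>v = inverse a\<close> the quotient
  \<open>(1 - u) / (1 - v)\<close> becomes \<open>\<kappa>\<close>.\<close>

lemma exists_small_reciprocal_sum:
  fixes a b :: real
  assumes "1 < a" "a < b"
  defines "\<kappa> \<equiv> a * (1 - b) / (b * (1 - a))"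
  obtains c :: "nat \<Rightarrow> real" where "(\<Sum>i\<le>m. c i) = 1"
    "\<And>l. l \<in> {a..b} \<Longrightarrow> \<bar>\<Sum>i\<le>m. c i * inverse l ^ i\<bar> \<le> 2 * ((sqrt \<kappa> - 1) / (sqrt \<kappa> + 1)) ^ m"
proof -
  have \<kappa>: "(1 - inverse b) / (1 - inverse a) = \<kappa>"
    using assms(1,2) unfolding \<kappa>_def by (simp add: field_simps)
  obtain P where P: "degree P \<le> m" "poly P 1 = 1"
      "\<And>y. y \<in> {inverse b..inverse a} \<Longrightarrow> \<bar>poly P y\<bar> \<le> 2 * ((sqrt \<kappa> - 1) / (sqrt \<kappa> + 1)) ^ m"
    using exists_small_poly[of "inverse b" "inverse a" m] assms(1,2)
    unfolding \<kappa> by (auto simp: inverse_less_1_iff)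
  \<comment> \<open>The degree may be below \<open>m\<close>; the sum is padded with zero
    coefficients.\<close>
  have eval: "poly P y = (\<Sum>i\<le>m. coeff P i * y ^ i)" for y
    unfolding poly_altdef using P(1)
    by (intro sum.mono_neutral_left) (auto simp: coeff_eq_0)
  show ?thesis
  proof (rule that[of "coeff P"])
    show "(\<Sum>i\<le>m. coeff P i) = 1" using eval[of 1] P(2) by simp
    fix l :: real assume "l \<in> {a..b}"
    then have "inverse l \<in> {inverse b..inverse a}"
      using assms(1,2) by (auto intro!: le_imp_inverse_le)
    then show "\<bar>\<Sum>i\<le>m. coeff P i * inverse l ^ i\<bar> \<le> 2 * ((sqrt \<kappa> - 1) / (sqrt \<kappa> + 1)) ^ m"
      using P(3) eval by simp
  qed
qed

section \<open>Functional calculus of a diagonalizable matrix\<close>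

definition diag_of :: "('n \<Rightarrow> real) \<Rightarrow> real ^ 'n ^ 'n"
  where "diag_of d = (\<chi> i j. if i = j then d i else 0)"

lemma diag_of_mult_vec: "diag_of d *v v = (\<chi> i. d i * v $ i)"
  by (simp add: diag_of_def matrix_vector_mult_def vec_eq_iff if_distrib[of "\<lambda>x. x * _"] cong: if_cong)

lemma transpose_diag_of: "transpose (diag_of d) = diag_of d"
  by (auto simp: diag_of_def transpose_def vec_eq_iff)

lemma mult_diag_of: "(B ** diag_of d) $ i $ j = B $ i $ j * d j"
  by (simp add: diag_of_def matrix_matrix_mult_def if_distrib[of "\<lambda>x. _ * x"] cong: if_cong)

lemma diag_of_mult: "(diag_of d ** B) $ i $ j = d i * B $ i $ j"
  by (simp add: diag_of_def matrix_matrix_mult_def if_distrib[of "\<lambda>x. x * _"] cong: if_cong)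

lemma diagonal_matrix_eq_diag_of: "diagonal_matrix D \<Longrightarrow> D = diag_of (\<lambda>i. D $ i $ i)"
  by (auto simp: diagonal_matrix_def diag_of_def vec_eq_iff)

lemma norm_diag_of_mult_vec_le:
  assumes "\<And>i. \<bar>d i\<bar> \<le> B"
  shows "norm (diag_of d *v v) \<le> B * norm v"
proof -
  \<comment> \<open>Index types are nonempty, and \<open>undefined\<close> names some index.\<close>
  have B: "B \<ge> 0" using assms[of undefined] by simp
  have "norm (diag_of d *v v) \<le> L2_set (\<lambda>i. B * norm (v $ i)) UNIV"
    unfolding norm_vec_def diag_of_mult_vec
    by (intro L2_set_mono) (auto simp: abs_mult intro: mult_right_mono assms)
  then show ?thesis using B by (simp add: L2_set_right_distrib norm_vec_def)
qed

lemma norm_mult_vec_le_mat_norm2: "norm (B *v v) \<le> mat_norm2 B * norm v"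
  unfolding mat_norm2_def using onorm[OF matrix_vector_mul_bounded_linear] .

text \<open>For diagonal \<open>L\<close> this is \<open>f(M)\<close> with
  \<open>M = W ** L ** matrix_inv W\<close>. It depends on \<open>f\<close> only through its values
  at the diagonal entries of \<open>L\<close>, so matrix identities reduce to scalar ones
  there.\<close>

definition spectral_fun :: "real ^ 'n ^ 'n \<Rightarrow> real ^ 'n ^ 'n \<Rightarrow> (real \<Rightarrow> real) \<Rightarrow> real ^ 'n ^ 'n"
  where "spectral_fun W L f = W ** diag_of (\<lambda>i. f (L $ i $ i)) ** matrix_inv W"

lemma spectral_fun_apply:
  "spectral_fun W L f *v v = W *v (diag_of (\<lambda>i. f (L $ i $ i)) *v (matrix_inv W *v v))"
  by (simp add: spectral_fun_def matrix_vector_mul_assoc matrix_mul_assoc)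

lemma matrix_inv_left_right:
  fixes W :: "real ^ 'n ^ 'n"
  assumes "invertible W"
  shows "matrix_inv W ** W = mat 1" "W ** matrix_inv W = mat 1"
  using someI_ex[of "\<lambda>V. W ** V = mat 1 \<and> V ** W = mat 1"] assms
  unfolding invertible_def matrix_inv_def by blast+

lemma matrix_inv_cancel:
  fixes W :: "real ^ 'n ^ 'n"
  assumes "invertible W"
  shows "matrix_inv W *v (W *v v) = v" "W *v (matrix_inv W *v v) = v"
  using matrix_inv_left_right[OF assms] by (simp_all add: matrix_vector_mul_assoc)

lemma spectral_fun_mult:
  assumes "invertible W"
  shows "spectral_fun W L f *v (spectral_fun W L g *v v) = spectral_fun W L (\<lambda>l. f l * g l) *v v"
  by (simp add: spectral_fun_apply matrix_inv_cancel[OF assms] diag_of_mult_vec mult.assoc)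

lemma spectral_fun_one: "invertible W \<Longrightarrow> spectral_fun W L (\<lambda>l. 1) *v v = v"
  by (simp add: spectral_fun_apply matrix_inv_cancel diag_of_mult_vec)

lemma spectral_fun_add:
  "spectral_fun W L f *v v + spectral_fun W L g *v v = spectral_fun W L (\<lambda>l. f l + g l) *v v"
  by (simp add: spectral_fun_apply diag_of_mult_vec flip: matrix_vector_right_distrib)
     (simp add: vec_eq_iff plus_vec_def algebra_simps)

lemma spectral_fun_scale: "c *\<^sub>R (spectral_fun W L f *v v) = spectral_fun W L (\<lambda>l. c * f l) *v v"
  by (simp add: spectral_fun_apply diag_of_mult_vec flip: matrix_vector_mult_scaleR)
     (simp add: vec_eq_iff scaleR_vec_def mult.assoc)

lemma spectral_fun_zero: "spectral_fun W L (\<lambda>l. 0) *v v = 0"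
  using spectral_fun_scale[of 0 W L "\<lambda>l. 0" v] by simp

lemma spectral_fun_sum:
  "(\<Sum>i\<in>I. c i *\<^sub>R (spectral_fun W L (f i) *v v)) = spectral_fun W L (\<lambda>l. \<Sum>i\<in>I. c i * f i l) *v v"
  by (induction I rule: infinite_finite_induct)
     (simp_all add: spectral_fun_zero spectral_fun_scale spectral_fun_add)

lemma spectral_fun_cong:
  "(\<And>i. f (L $ i $ i) = g (L $ i $ i)) \<Longrightarrow> spectral_fun W L f = spectral_fun W L g"
  by (simp add: spectral_fun_def)

lemma spectral_fun_id: "diagonal_matrix L \<Longrightarrow> spectral_fun W L (\<lambda>l. l) = W ** L ** matrix_inv W"
  unfolding spectral_fun_def by (subst (5) diagonal_matrix_eq_diag_of) auto

lemma spectral_fun_funpow: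
  assumes "invertible W"
  shows "(((*v) (spectral_fun W L (\<lambda>l. l))) ^^ n) v = spectral_fun W L (\<lambda>l. l ^ n) *v v"
  by (induction n) (simp_all add: spectral_fun_one[OF assms] spectral_fun_mult[OF assms])

text \<open>The columns of \<open>W\<close> are eigenvectors. This transfers the assumption on the
  eigenvalues to the diagonal of \<open>L\<close>.\<close>

lemma eigenvalue_diagonal_entry:
  assumes "invertible W"
  shows "eigenvalue (spectral_fun W L (\<lambda>l. l)) (L $ i $ i)"
proof -
  let ?v = "W *v axis i 1"
  have "matrix_inv W *v ?v \<noteq> 0" by (simp add: matrix_inv_cancel[OF assms] axis_eq_0_iff)
  then have "?v \<noteq> 0" by auto
  moreover have "diag_of (\<lambda>i. L $ i $ i) *v axis i 1 = L $ i $ i *\<^sub>R axis i 1"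
    by (auto simp: diag_of_mult_vec vec_eq_iff axis_def)
  then have "spectral_fun W L (\<lambda>l. l) *v ?v = L $ i $ i *\<^sub>R ?v"
    by (simp add: spectral_fun_apply matrix_inv_cancel[OF assms] matrix_vector_mult_scaleR)
  ultimately show ?thesis unfolding eigenvalue_def by blast
qed

text \<open>The outer factors \<open>W\<close> and \<open>matrix_inv W\<close> each cost their norm,
  which is how the condition number arises.\<close>

lemma norm_spectral_fun_le:
  assumes "\<And>i. \<bar>f (L $ i $ i)\<bar> \<le> B"
  shows "norm (spectral_fun W L f *v v) \<le> cond2 W * B * norm v"
proof -
  have B: "B \<ge> 0" using assms[of undefined] by simp
  have W: "mat_norm2 W \<ge> 0"
    unfolding mat_norm2_def by (rule onorm_pos_le[OF matrix_vector_mul_bounded_linear])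
  have "norm (spectral_fun W L f *v v)
      \<le> mat_norm2 W * norm (diag_of (\<lambda>i. f (L $ i $ i)) *v (matrix_inv W *v v))"
    unfolding spectral_fun_apply by (rule norm_mult_vec_le_mat_norm2)
  also have "\<dots> \<le> mat_norm2 W * (B * norm (matrix_inv W *v v))"
    by (intro mult_left_mono norm_diag_of_mult_vec_le assms W)
  also have "\<dots> \<le> mat_norm2 W * (B * (mat_norm2 (matrix_inv W) * norm v))"
    by (intro mult_left_mono norm_mult_vec_le_mat_norm2 W B)
  finally show ?thesis by (simp add: cond2_def algebra_simps)
qed

text \<open>If \<open>M\<close> is symmetric, then the Gram matrix \<open>W\<^sup>T W\<close> commutes with \<open>L\<close>, hence with every \<open>f(L)\<close>.\<close>

lemma transpose_spectral_fun:
  assumes "invertible W" and sym: "symmetric_matrix (spectral_fun W L (\<lambda>l. l))"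
  shows "transpose (spectral_fun W L f) = spectral_fun W L f"
proof -
  let ?D = "\<lambda>f. diag_of (\<lambda>i. f (L $ i $ i))"
  let ?V = "matrix_inv W" and ?G = "transpose W ** W"
  have inv: "?V ** W = mat 1" "W ** ?V = mat 1"
    using assms(1) by (simp_all add: matrix_inv_left_right)
  have invT: "transpose W ** transpose ?V = mat 1" "transpose ?V ** transpose W = mat 1"
    using inv by (metis matrix_transpose_mul transpose_mat)+
  have tr: "transpose (spectral_fun W L g) = transpose ?V ** ?D g ** transpose W" for g
    by (simp add: spectral_fun_def matrix_transpose_mul transpose_diag_of matrix_mul_assoc)
  have "?G ** ?D (\<lambda>l. l) = transpose W ** spectral_fun W L (\<lambda>l. l) ** W"
    by (simp add: spectral_fun_def inv flip: matrix_mul_assoc)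
  also have "\<dots> = transpose W ** (transpose ?V ** ?D (\<lambda>l. l) ** transpose W) ** W"
    using sym tr[of "\<lambda>l. l"] by (simp add: symmetric_matrix_def)
  also have "\<dots> = ?D (\<lambda>l. l) ** ?G"
    by (simp add: matrix_mul_assoc invT)
  finally have "(?G ** ?D (\<lambda>l. l)) $ i $ j = (?D (\<lambda>l. l) ** ?G) $ i $ j" for i j
    by simp
  then have comm: "?G $ i $ j * L $ j $ j = L $ i $ i * ?G $ i $ j" for i j
    by (simp only: mult_diag_of diag_of_mult)
  \<comment> \<open>By \<open>comm\<close>, either the Gram entry vanishes or the two diagonal
    entries of \<open>L\<close> coincide, and then so do their images under
    \<open>f\<close>.\<close>
  have "?G $ i $ j * f (L $ j $ j) = f (L $ i $ i) * ?G $ i $ j" for i j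
    using comm[of i j] by (cases "?G $ i $ j = 0") auto
  then have "?G ** ?D f = ?D f ** ?G"
    by (simp add: vec_eq_iff mult_diag_of diag_of_mult)
  moreover have "transpose ?V ** (?D f ** ?G) ** ?V = transpose ?V ** ?D f ** transpose W"
    by (simp add: inv flip: matrix_mul_assoc)
  moreover have "transpose ?V ** (?G ** ?D f) ** ?V = W ** ?D f ** ?V"
    by (simp add: matrix_mul_assoc invT)
  ultimately have "transpose ?V ** ?D f ** transpose W = W ** ?D f ** ?V" by (simp only:)
  then show ?thesis unfolding tr by (simp add: spectral_fun_def)
qed

text \<open>The idea is that \<open>B\<^sup>2 I - f(M)\<^sup>2 = h(M)\<^sup>2\<close> is positive semidefinite, where \<open>h = sqrt (B\<^sup>2 - f\<^sup>2)\<close>.\<close>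

lemma norm_spectral_fun_le_symmetric:
  assumes W: "invertible W" and sym: "symmetric_matrix (spectral_fun W L (\<lambda>l. l))"
    and B: "\<And>i. \<bar>f (L $ i $ i)\<bar> \<le> B"
  shows "norm (spectral_fun W L f *v v) \<le> B * norm v"
proof -
  have "B \<ge> 0" using B[of undefined] by simp
  \<comment> \<open>Symmetry enters here: moving \<open>g(M)\<close> across the inner product leaves
    it unchanged and produces \<open>g(M)\<close> squared.\<close>
  have sq: "(norm (spectral_fun W L g *v v))\<^sup>2 = v \<bullet> (spectral_fun W L (\<lambda>l. g l * g l) *v v)" for g
  proof -
    have "(spectral_fun W L g *v v) \<bullet> (spectral_fun W L g *v v)
        = v \<bullet> (transpose (spectral_fun W L g) *v (spectral_fun W L g *v v))"
      unfolding transpose_matrix_vector inner_commute[of v] dot_lmul_matrix ..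
    then show ?thesis
      by (simp add: power2_norm_eq_inner transpose_spectral_fun[OF W sym] spectral_fun_mult[OF W])
  qed
  define h where "h l = sqrt (B\<^sup>2 - (f l)\<^sup>2)" for l
  \<comment> \<open>The radicand in \<open>h\<close> is nonnegative at the diagonal entries, the
    only points that matter. The factor \<open>1\<close> matches the shape of
    \<open>spectral_fun_scale\<close>.\<close>
  have "f (L $ i $ i) * f (L $ i $ i) + h (L $ i $ i) * h (L $ i $ i) = B\<^sup>2 * 1" for i
  proof -
    have "(f (L $ i $ i))\<^sup>2 \<le> B\<^sup>2" using B[of i] \<open>B \<ge> 0\<close> by (simp only: power2_le_iff_abs_le)
    then have "h (L $ i $ i) * h (L $ i $ i) = B\<^sup>2 - (f (L $ i $ i))\<^sup>2"
      unfolding h_def real_sqrt_mult_self by (simp only: abs_of_nonneg diff_ge_0_iff_ge)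
    then show ?thesis by (simp only: power2_eq_square mult_1_right add_diff_cancel_left' diff_add_cancel)
  qed
  then have "spectral_fun W L (\<lambda>l. f l * f l + h l * h l) = spectral_fun W L (\<lambda>l. B\<^sup>2 * 1)"
    by (rule spectral_fun_cong)
  then have "spectral_fun W L (\<lambda>l. f l * f l) *v v + spectral_fun W L (\<lambda>l. h l * h l) *v v = B\<^sup>2 *\<^sub>R v"
    using spectral_fun_scale[of "B\<^sup>2" W L "\<lambda>l. 1" v]
    by (simp only: spectral_fun_add spectral_fun_one[OF W])
  from arg_cong[OF this, of "inner v"]
  have "(norm (spectral_fun W L f *v v))\<^sup>2 + (norm (spectral_fun W L h *v v))\<^sup>2 = B\<^sup>2 * (v \<bullet> v)"
    unfolding sq by (simp only: inner_add_right inner_scaleR_right)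
  then have "(norm (spectral_fun W L f *v v))\<^sup>2 \<le> (B * norm v)\<^sup>2"
    using zero_le_power2[of "norm (spectral_fun W L h *v v)"]
    unfolding power_mult_distrib power2_norm_eq_inner[of v] by linarith
  then show ?thesis using \<open>B \<ge> 0\<close> by (rule power2_le_imp_le[OF _ mult_nonneg_nonneg]) simp
qed

section \<open>Residual decay over one cycle\<close>

text \<open>The update is \<open>q\<close> applied to the mixed point \<open>x k + S\<close>, with
  \<open>S\<close> the combination of differences of iterates. The minimised vector \<open>w\<close>
  is the residual at that point, and one application of \<open>q\<close> multiplies a residual by
  \<open>T\<close>.\<close>

lemma linear_anderson_step_residual:
  fixes T :: "'a::real_inner \<Rightarrow> 'a"
  assumes "linear T" and q: "q = (\<lambda>y. T y + d)" and step: "anderson_step q m x k"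
  obtains w where "residual q (x (Suc k)) = T w"
    "\<And>g. norm w \<le> norm (residual q (x k)
       + (\<Sum>i = 1..min m k. g i *\<^sub>R (residual q (x k) - residual q (x (k - i)))))"
proof -
  interpret T: linear T by fact
  obtain g where g: "is_arg_min (anderson_objective q m x k) (\<lambda>_. True) g"
      and xs: "x (Suc k) = q (x k) + (\<Sum>i = 1..min m k. g i *\<^sub>R (q (x k) - q (x (k - i))))"
    using step unfolding anderson_step_def by blast
  let ?R = "\<lambda>g. residual q (x k)
       + (\<Sum>i = 1..min m k. g i *\<^sub>R (residual q (x k) - residual q (x (k - i))))"
  show ?thesis
  proof (rule that[of "?R g"])
    show "norm (?R g) \<le> norm (?R h)" for h
      using g unfolding is_arg_min_linorder anderson_objective_def
      by (meson norm_ge_zero power2_le_imp_le)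
    define S where "S = (\<Sum>i = 1..min m k. g i *\<^sub>R (x k - x (k - i)))"
    have TS: "T S = (\<Sum>i = 1..min m k. g i *\<^sub>R (T (x k) - T (x (k - i))))"
      by (simp add: S_def T.sum T.scaleR T.diff)
    then have x1: "x (Suc k) = T (x k) + d + T S" unfolding xs q by simp
    have "(\<Sum>i = 1..min m k. g i *\<^sub>R (residual q (x k) - residual q (x (k - i)))) = T S - S"
      unfolding TS unfolding S_def sum_subtractf[symmetric]
      by (intro sum.cong) (simp_all add: residual_def q algebra_simps)
    then have Rg: "?R g = T (x k) + d - x k + (T S - S)" by (simp add: residual_def q)
    show "residual q (x (Suc k)) = T (?R g)"
      unfolding Rg by (simp add: residual_def x1 q T.add T.diff)
  qed
qed

text \<open>The factor \<open>K\<close> covers the fixed-point phase together with the minimisation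
  in the first Anderson step; \<open>C ^ s\<close> comes from one application of \<open>T\<close> in
  each of the \<open>s\<close> Anderson steps. Powers \<open>t - i\<close> keep inverses of
  \<open>T\<close> out of the argument.\<close>

lemma residual_cycle_le:
  fixes T :: "'a::real_inner \<Rightarrow> 'a"
  assumes T: "linear T" and q: "q = (\<lambda>y. T y + d)"
    and iter: "aAA_FP_iterates q m s t x" and "s \<ge> 1" "m \<le> t"
    and C: "\<And>v. norm (T v) \<le> C * norm v" "C \<ge> 0"
    and c: "(\<Sum>i\<le>m. c i) = 1"
    and K: "\<And>v. norm (\<Sum>i\<le>m. c i *\<^sub>R (T ^^ (t - i)) v) \<le> K * norm v"
  shows "norm (residual q (x (Suc j * (t + s)))) \<le> K * C ^ s * norm (residual q (x (j * (t + s))))"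
proof -
  interpret T: linear T by fact
  let ?p = "t + s" and ?r = "\<lambda>k. residual q (x k)"
  define k where "k = j * ?p"
  define r where "r = ?r k"
  have md: "(k + i) mod (s + t) = i" if "i < ?p" for i
    using that by (simp add: k_def add.commute[of s t])
  have fp: "x (Suc (k + i)) = q (x (k + i))" if "i < t" for i
    using iter that md[of i] unfolding aAA_FP_iterates_def by (metis trans_less_add1)
  have an: "anderson_step q m x (k + i)" if "i \<ge> t" "i < ?p" for i
    using iter that md[of i] unfolding aAA_FP_iterates_def by (metis not_less)
  have pow: "?r (k + i) = (T ^^ i) r" if "i \<le> t" for i
    using that
  proof (induction i)
    case (Suc i)
    have "?r (k + Suc i) = T (?r (k + i))"
      using fp[of i] Suc.prems by (simp add: residual_def q T.diff T.add)
    then show ?case using Suc by simp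
  qed (simp add: r_def)
  have first: "norm (?r (k + Suc t)) \<le> K * C * norm r"
  proof -
    have "t < ?p" using \<open>s \<ge> 1\<close> by simp
    obtain w where w: "?r (Suc (k + t)) = T w"
      "\<And>g. norm w \<le> norm (?r (k + t)
         + (\<Sum>i = 1..min m (k + t). g i *\<^sub>R (?r (k + t) - ?r (k + t - i))))"
      by (rule linear_anderson_step_residual[OF T q an[OF order_refl \<open>t < ?p\<close>]]) (rule that)
    \<comment> \<open>As \<open>m \<le> t\<close>, the window does not reach back past index
      \<open>k\<close>, so it holds only the start of this cycle and its fixed-point
      iterates.\<close>
    have pow_diff: "?r (k + t - i) = (T ^^ (t - i)) r" if "i \<le> m" for i
      using pow[of "t - i"] that \<open>m \<le> t\<close> by (simp add: add_diff_assoc)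
    have mn: "min m (k + t) = m" using \<open>m \<le> t\<close> by simp
    have split: "(\<Sum>i\<le>m. f i) = f 0 + (\<Sum>i = 1..m. f i)" for f :: "nat \<Rightarrow> 'b::comm_monoid_add"
      by (simp add: atMost_atLeast0 sum.atLeast_Suc_atMost)
    \<comment> \<open>Trial coefficients \<open>- c i\<close> leave weight
      \<open>1 - (c 1 + ... + c m) = c 0\<close> on the current residual, so the objective becomes
      the combination bounded by \<open>K\<close>.\<close>
    have "(\<Sum>i = 1..m. (- c i) *\<^sub>R (?r (k + t) - ?r (k + t - i)))
        = (\<Sum>i = 1..m. c i *\<^sub>R (T ^^ (t - i)) r - c i *\<^sub>R (T ^^ t) r)"
      by (intro sum.cong) (simp_all add: pow_diff pow scaleR_diff_right)
    also have "\<dots> = (\<Sum>i = 1..m. c i *\<^sub>R (T ^^ (t - i)) r) - (1 - c 0) *\<^sub>R (T ^^ t) r"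
      using c split[of c] by (simp add: sum_subtractf flip: scaleR_left.sum)
    finally have "?r (k + t) + (\<Sum>i = 1..min m (k + t). (- c i) *\<^sub>R (?r (k + t) - ?r (k + t - i)))
        = (\<Sum>i\<le>m. c i *\<^sub>R (T ^^ (t - i)) r)"
      unfolding mn split[of "\<lambda>i. c i *\<^sub>R (T ^^ (t - i)) r"] by (simp add: pow algebra_simps)
    then have "norm w \<le> K * norm r"
      using w(2)[of "\<lambda>i. - c i"] K[of r] by simp
    then have "C * norm w \<le> C * (K * norm r)" using C(2) by (rule mult_left_mono)
    then show ?thesis using w(1) C(1)[of w] by (simp add: mult_ac)
  qed
  have "norm (?r (k + t + Suc i)) \<le> K * C ^ Suc i * norm r" if "i < s" for i
    using that
  proof (induction i)
    case 0
    then show ?case using first by simp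
  next
    case (Suc i)
    have "t \<le> t + Suc i" "t + Suc i < ?p" using Suc.prems by auto
    then obtain w where w: "?r (Suc (k + (t + Suc i))) = T w"
      "\<And>g. norm w \<le> norm (?r (k + (t + Suc i))
         + (\<Sum>n = 1..min m (k + (t + Suc i)).
              g n *\<^sub>R (?r (k + (t + Suc i)) - ?r (k + (t + Suc i) - n))))"
      using linear_anderson_step_residual[OF T q an] by blast
    \<comment> \<open>From the second Anderson step on, the history is no longer made of powers of
      \<open>T\<close> alone, so only the trivial comparison is used.\<close>
    have "norm w \<le> norm (?r (k + t + Suc i))" using w(2)[of "\<lambda>_. 0"] by (simp add: add.assoc)
    also have "\<dots> \<le> K * C ^ Suc i * norm r" using Suc by simp
    finally have "C * norm w \<le> C * (K * C ^ Suc i * norm r)" using C(2) by (rule mult_left_mono)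
    then show ?case using w(1) C(1)[of w] by (simp add: mult_ac add.assoc)
  qed
  moreover have "k + t + Suc (s - 1) = Suc j * ?p" "Suc (s - 1) = s"
    using \<open>s \<ge> 1\<close> by (simp_all add: k_def)
  ultimately show ?thesis using \<open>s \<ge> 1\<close> unfolding r_def k_def by (metis lessI)
qed

section \<open>Convergence of residuals and of errors\<close>

lemma tendsto_zero_of_contraction:
  fixes f :: "nat \<Rightarrow> 'a::real_normed_vector"
  assumes "0 \<le> C" "C < 1" and step: "\<And>j. norm (f (Suc j)) \<le> C * norm (f j)"
  shows "f \<longlonglongrightarrow> 0"
proof -
  have bound: "norm (f j) \<le> C ^ j * norm (f 0)" for j
  proof (induction j)
    case (Suc j)
    have "norm (f (Suc j)) \<le> C * norm (f j)" by (rule step)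
    also have "\<dots> \<le> C * (C ^ j * norm (f 0))" using Suc assms(1) by (rule mult_left_mono)
    finally show ?case by (simp add: mult.assoc)
  qed simp
  have "(\<lambda>j. C ^ j * norm (f 0)) \<longlonglongrightarrow> 0"
    using assms(1,2) by (intro tendsto_mult_left_zero LIMSEQ_realpow_zero)
  then show ?thesis
    by (rule Lim_null_comparison[rotated]) (simp add: bound)
qed

text \<open>Residuals shrink by \<open>B * C ^ (t + s)\<close> per cycle, and errors follow because
  \<open>M - I\<close> is invertible when all eigenvalues exceed 1. The bounds \<open>B\<close> and
  \<open>C\<close> stay abstract to serve both the general and the symmetric case.\<close>

lemma spectral_aAA_FP_tendsto:
  fixes W L :: "real ^ 'n ^ 'n"
  defines "M \<equiv> spectral_fun W L (\<lambda>l. l)"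
  assumes W: "invertible W"
    and fix_pt: "xstar = M *v xstar + rhs"
    and q: "q = (\<lambda>y. M *v y + rhs)"
    and "s \<ge> 1" "m \<le> t"
    and iter: "aAA_FP_iterates q m s t x"
    and spec: "\<And>i. L $ i $ i > 1"
    and C: "\<And>v. norm (M *v v) \<le> C * norm v" "C \<ge> 0"
    and c: "(\<Sum>i\<le>m. c i) = 1"
    and B: "\<And>v. norm (spectral_fun W L (\<lambda>l. \<Sum>i\<le>m. c i * inverse l ^ i) *v v) \<le> B * norm v" "B \<ge> 0"
    and contr: "B * C ^ (t + s) < 1"
  shows "(\<lambda>j. x (j * (t + s))) \<longlonglongrightarrow> xstar"
proof -
  let ?T = "(*v) M"
  have pw: "(?T ^^ n) v = spectral_fun W L (\<lambda>l. l ^ n) *v v" for n v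
    unfolding M_def by (rule spectral_fun_funpow[OF W])
  have C_pow: "norm ((?T ^^ n) v) \<le> C ^ n * norm v" for n v
  proof (induction n)
    case (Suc n)
    have "norm ((?T ^^ Suc n) v) \<le> C * norm ((?T ^^ n) v)" using C(1) by simp
    also have "\<dots> \<le> C * (C ^ n * norm v)" using Suc C(2) by (rule mult_left_mono)
    finally show ?case by (simp add: mult.assoc)
  qed simp
  have K: "norm (\<Sum>i\<le>m. c i *\<^sub>R (?T ^^ (t - i)) v) \<le> B * C ^ t * norm v" for v
  proof -
    \<comment> \<open>Factoring out \<open>l ^ t\<close> separates the polynomial in
      \<open>inverse l\<close>, controlled by \<open>B\<close>, from the \<open>t\<close>
      fixed-point steps, controlled by \<open>C ^ t\<close>.\<close>
    have "(\<Sum>i\<le>m. c i * l ^ (t - i)) = (\<Sum>i\<le>m. c i * inverse l ^ i) * l ^ t" if "l > 1" for l :: real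
    proof -
      have "l ^ (t - i) = inverse l ^ i * l ^ t" if "i \<le> m" for i
        using that \<open>m \<le> t\<close> \<open>l > 1\<close> by (simp add: power_diff power_inverse field_simps)
      then show ?thesis by (simp add: sum_distrib_right mult.assoc)
    qed
    then have "spectral_fun W L (\<lambda>l. \<Sum>i\<le>m. c i * l ^ (t - i))
        = spectral_fun W L (\<lambda>l. (\<Sum>i\<le>m. c i * inverse l ^ i) * l ^ t)"
      using spec by (intro spectral_fun_cong) auto
    then have "(\<Sum>i\<le>m. c i *\<^sub>R (?T ^^ (t - i)) v)
        = spectral_fun W L (\<lambda>l. \<Sum>i\<le>m. c i * inverse l ^ i) *v ((?T ^^ t) v)"
      unfolding pw spectral_fun_mult[OF W] by (simp only: spectral_fun_sum)
    also have "norm \<dots> \<le> B * norm ((?T ^^ t) v)" by (rule B(1))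
    also have "\<dots> \<le> B * (C ^ t * norm v)" using C_pow B(2) by (rule mult_left_mono)
    finally show ?thesis by (simp add: mult.assoc)
  qed
  have lim: "(\<lambda>j. residual q (x (j * (t + s)))) \<longlonglongrightarrow> 0"
  proof (rule tendsto_zero_of_contraction)
    show "0 \<le> B * C ^ (t + s)" using B(2) C(2) by simp
    show "norm (residual q (x (Suc j * (t + s)))) \<le> B * C ^ (t + s) * norm (residual q (x (j * (t + s))))" for j
      using residual_cycle_le[OF matrix_vector_mul_linear q iter \<open>s \<ge> 1\<close> \<open>m \<le> t\<close> C c K]
      by (simp add: power_add mult.assoc)
  qed (rule contr)
  \<comment> \<open>This is the inverse of \<open>M - I\<close>, and the residual at
    \<open>y\<close> is \<open>M - I\<close> applied to \<open>y - xstar\<close>.\<close>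
  define R where "R = spectral_fun W L (\<lambda>l. inverse (l - 1))"
  have inv: "R *v residual q y = y - xstar" for y
  proof -
    let ?v = "y - xstar"
    have "residual q y = M *v ?v + (-1) *\<^sub>R ?v"
      using fix_pt by (simp add: residual_def q matrix_vector_mult_diff_distrib algebra_simps)
    also have "\<dots> = spectral_fun W L (\<lambda>l. l + (-1) * 1) *v ?v"
      by (simp only: M_def spectral_fun_one[OF W] flip: spectral_fun_add spectral_fun_scale)
    finally have "R *v residual q y = spectral_fun W L (\<lambda>l. inverse (l - 1) * (l + (-1) * 1)) *v ?v"
      by (simp only: R_def spectral_fun_mult[OF W])
    also have "spectral_fun W L (\<lambda>l. inverse (l - 1) * (l + (-1) * 1)) = spectral_fun W L (\<lambda>l. 1)"
      using spec by (intro spectral_fun_cong) (simp add: less_imp_neq[symmetric])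
    finally show ?thesis by (simp add: spectral_fun_one[OF W])
  qed
  have "(\<lambda>j. R *v residual q (x (j * (t + s)))) \<longlonglongrightarrow> R *v 0"
    using lim by (rule bounded_linear.tendsto[OF matrix_vector_mul_bounded_linear])
  then have "(\<lambda>j. x (j * (t + s)) - xstar) \<longlonglongrightarrow> 0" by (simp add: inv)
  then show ?thesis using Lim_null by blast
qed

theorem corollary1:
  fixes A M W L :: "real ^ 'n ^ 'n"
    and rhs xstar :: "real ^ 'n"
    and q :: "real ^ 'n \<Rightarrow> real ^ 'n"
    and x :: "nat \<Rightarrow> real ^ 'n"
    and a b :: real
    and m s t p :: nat
  assumes "A *v xstar = rhs"
    and "M = mat 1 - A"
    and "q = (\<lambda>y. M *v y + rhs)"
    and "s \<ge> 1" and "m \<le> t" and "p = t + s"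
    and "aAA_FP_iterates q m s t x"
    and "invertible W" and "diagonal_matrix L" and "M = W ** L ** matrix_inv W"
    and "1 < a" and "a < b"
    and "\<And>l. eigenvalue M l \<Longrightarrow> l \<in> {a..b}"
  shows "(2 * cond2 W
            * ((sqrt (a * (1 - b) / (b * (1 - a))) - 1)
               / (sqrt (a * (1 - b) / (b * (1 - a))) + 1)) ^ m
            * mat_norm2 M ^ (t + s) < 1
          \<longrightarrow> (\<lambda>j. x (j * p)) \<longlonglongrightarrow> xstar)
       \<and> (symmetric_matrix M
          \<and> 2 * ((sqrt (a * (1 - b) / (b * (1 - a))) - 1)
                 / (sqrt (a * (1 - b) / (b * (1 - a))) + 1)) ^ m
              * b ^ (t + s) < 1
          \<longrightarrow> (\<lambda>j. x (j * p)) \<longlonglongrightarrow> xstar)"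
proof -
  let ?\<kappa> = "a * (1 - b) / (b * (1 - a))"
  let ?\<rho> = "(sqrt ?\<kappa> - 1) / (sqrt ?\<kappa> + 1)"
  have M: "M = spectral_fun W L (\<lambda>l. l)"
    using assms(9,10) by (simp add: spectral_fun_id)
  have spec: "L $ i $ i \<in> {a..b}" for i
    using assms(13) eigenvalue_diagonal_entry[OF assms(8)] unfolding M by blast
  then have spec1: "L $ i $ i > 1" for i
    using assms(11) by (meson atLeastAtMost_iff less_le_trans)
  have fix_pt: "xstar = M *v xstar + rhs"
    using assms(1,2) by (simp add: matrix_vector_mult_diff_rdistrib)
  obtain c where c: "(\<Sum>i\<le>m. c i) = 1"
      "\<And>l. l \<in> {a..b} \<Longrightarrow> \<bar>\<Sum>i\<le>m. c i * inverse l ^ i\<bar> \<le> 2 * ?\<rho> ^ m"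
    using exists_small_reciprocal_sum[OF assms(11,12)] by blast
  define P where "P l = (\<Sum>i\<le>m. c i * inverse l ^ i)" for l
  have P: "\<bar>P (L $ i $ i)\<bar> \<le> 2 * ?\<rho> ^ m" for i
    unfolding P_def using c(2)[OF spec] .
  have P_nonneg: "0 \<le> 2 * ?\<rho> ^ m" using P[of undefined] by linarith
  have norm_nonneg: "mat_norm2 B \<ge> 0" for B :: "real ^ 'n ^ 'n"
    unfolding mat_norm2_def by (rule onorm_pos_le[OF matrix_vector_mul_bounded_linear])
  \<comment> \<open>The general case takes \<open>C = mat_norm2 M\<close> and puts the factor
    \<open>cond2 W\<close> into \<open>B\<close>; the symmetric case takes \<open>C = b\<close> and
    \<open>B\<close> without that factor.\<close>
  have conv: "(\<lambda>j. x (j * p)) \<longlonglongrightarrow> xstar"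
    if "\<And>v. norm (M *v v) \<le> C * norm v" "C \<ge> 0" "\<And>v. norm (spectral_fun W L P *v v) \<le> B * norm v"
      "B \<ge> 0" "B * C ^ (t + s) < 1" for B C
    using spectral_aAA_FP_tendsto[OF assms(8) fix_pt[unfolded M] assms(3)[unfolded M] assms(4,5,7) spec1
        that(1)[unfolded M] that(2) c(1) that(3)[unfolded P_def] that(4,5)] assms(6) by simp
  show ?thesis
  proof (intro conjI impI; (elim conjE)?)
    assume "2 * cond2 W * ?\<rho> ^ m * mat_norm2 M ^ (t + s) < 1"
    then show "(\<lambda>j. x (j * p)) \<longlonglongrightarrow> xstar"
      using P_nonneg norm_nonneg
      by (intro conv[of "mat_norm2 M" "cond2 W * (2 * ?\<rho> ^ m)"] norm_mult_vec_le_mat_norm2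
          norm_spectral_fun_le[of P, OF P]) (simp_all add: cond2_def ac_simps)
  next
    assume sym: "symmetric_matrix M" and small: "2 * ?\<rho> ^ m * b ^ (t + s) < 1"
    have "norm (M *v v) \<le> b * norm v" for v
    proof -
      \<comment> \<open>The diagonal entries are positive, so the symmetric norm bound for the
        identity function yields \<open>b\<close>.\<close>
      have "\<bar>L $ i $ i\<bar> \<le> b" for i using spec[of i] spec1[of i] by simp
      then show ?thesis
        using norm_spectral_fun_le_symmetric[OF assms(8) sym[unfolded M], where f = "\<lambda>l. l"]
        unfolding M by blast
    qed
    then show "(\<lambda>j. x (j * p)) \<longlonglongrightarrow> xstar"
      using P_nonneg small assms(11,12)
      by (intro conv[of b "2 * ?\<rho> ^ m"] norm_spectral_fun_le_symmetric[OF assms(8) sym[unfolded M], of P, OF P])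
         simp_all
  qed
qed

end
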